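(* Let $G$ be a unique product monoid, $S$ a $G$-graded ring, $M$ a graded right $S$-module, and $N$ a prime submodule of $M$. Then $\operatorname{ann} N$ is a homogeneous prime ideal of $S$, and it is equal to $\operatorname{ann} N'$ for some prime, graded submodule $N'$ of $M$.
   Context: Rings have $1$, modules are unital right modules, ideals are two-sided. A unique product monoid is a monoid $G$ (identity $e$) such that whenever $X,Y$ are nonempty finite subsets of $G$, there exist $x\in X$, $y\in Y$ with $xy\ne x'y'$ for every pair $(x',y')\in X\times Y$ different from $(x,y)$. A ring $S=\bigoplus_{g\in G}S_g$ is $G$-graded if $S_gS_h\subseteq S_{gh}$ for all $g,h\in G$ and $1\in S_e$; a right $S$-module $M=\bigoplus_{g\in G}M_g$ is graded if $M_gS_h\subseteq M_{gh}$ for all $g,h$. A subset of a graded group is homogeneous if it contains all the homogeneous components of each of its elements (a graded submodule is a homogeneous submodule). $\operatorname{ann} X=\{s\in S : xs=0 \text{ for all } x\in X\}$. A nonzero module $M$ is prime if $\operatorname{ann} N=\operatorname{ann} M$ for all nonzero submodules $N$ of $M$. *)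

theory Defs
  imports "HOL-Algebra.Ideal_Product"
begin

locale unique_product_monoid = monoid G for G (structure) +
  assumes unique_product:
    "\<lbrakk>X \<subseteq> carrier G; Y \<subseteq> carrier G; finite X; finite Y; X \<noteq> {}; Y \<noteq> {}\<rbrakk> \<Longrightarrow>
      \<exists>x\<in>X. \<exists>y\<in>Y. \<forall>(x', y') \<in> X \<times> Y. (x', y') \<noteq> (x, y) \<longrightarrow> x \<otimes> y \<noteq> x' \<otimes> y'"


text \<open>
  The library's modules are left modules over commutative rings, and its prime ideals live in
  commutative rings, so the noncommutative one-sided notions are introduced here. As for the
  library's modules, the record extends the one for rings, whose multiplication and unit are
  not used.
\<close>

record ('s, 'm) right_module = "'m ring" +
  rsmult :: "'m \<Rightarrow> 's \<Rightarrow> 'm" (infixl \<open>\<star>\<index>\<close> 70)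

locale right_module = S?: ring S + M?: abelian_group M
  for S (structure) and M (structure) +
  assumes rsmult_closed:
      "\<lbrakk>x \<in> carrier M; s \<in> carrier S\<rbrakk> \<Longrightarrow> x \<star>\<^bsub>M\<^esub> s \<in> carrier M"
    and rsmult_add_left:
      "\<lbrakk>x \<in> carrier M; y \<in> carrier M; s \<in> carrier S\<rbrakk> \<Longrightarrow>
        (x \<oplus>\<^bsub>M\<^esub> y) \<star>\<^bsub>M\<^esub> s = x \<star>\<^bsub>M\<^esub> s \<oplus>\<^bsub>M\<^esub> y \<star>\<^bsub>M\<^esub> s"
    and rsmult_add_right:
      "\<lbrakk>x \<in> carrier M; s \<in> carrier S; t \<in> carrier S\<rbrakk> \<Longrightarrow>
        x \<star>\<^bsub>M\<^esub> (s \<oplus>\<^bsub>S\<^esub> t) = x \<star>\<^bsub>M\<^esub> s \<oplus>\<^bsub>M\<^esub> x \<star>\<^bsub>M\<^esub> t"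
    and rsmult_assoc:
      "\<lbrakk>x \<in> carrier M; s \<in> carrier S; t \<in> carrier S\<rbrakk> \<Longrightarrow>
        x \<star>\<^bsub>M\<^esub> (s \<otimes>\<^bsub>S\<^esub> t) = (x \<star>\<^bsub>M\<^esub> s) \<star>\<^bsub>M\<^esub> t"
    and rsmult_one:
      "x \<in> carrier M \<Longrightarrow> x \<star>\<^bsub>M\<^esub> \<one>\<^bsub>S\<^esub> = x"

locale right_submodule = additive_subgroup N M
  for N and S (structure) and M (structure) +
  assumes rsmult_closed:
    "\<lbrakk>x \<in> N; s \<in> carrier S\<rbrakk> \<Longrightarrow> x \<star>\<^bsub>M\<^esub> s \<in> N"

definition ann :: "('s, 'a) ring_scheme \<Rightarrow> ('s, 'm, 'b) right_module_scheme \<Rightarrow> 'm set \<Rightarrow> 's set"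
  where "ann S M X = {s \<in> carrier S. \<forall>x\<in>X. x \<star>\<^bsub>M\<^esub> s = \<zero>\<^bsub>M\<^esub>}"

definition prime_module :: "('s, 'a) ring_scheme \<Rightarrow> ('s, 'm, 'b) right_module_scheme \<Rightarrow> bool"
  where "prime_module S M \<longleftrightarrow>
    right_module S M \<and> carrier M \<noteq> {\<zero>\<^bsub>M\<^esub>} \<and>
    (\<forall>N. right_submodule N S M \<longrightarrow> N \<noteq> {\<zero>\<^bsub>M\<^esub>} \<longrightarrow> ann S M N = ann S M (carrier M))"

definition prime_submodule ::
    "'m set \<Rightarrow> ('s, 'a) ring_scheme \<Rightarrow> ('s, 'm, 'b) right_module_scheme \<Rightarrow> bool"
  where "prime_submodule N S M \<longleftrightarrow>
    right_submodule N S M \<and> prime_module S (M\<lparr>carrier := N\<rparr>)"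

definition prime_ideal :: "'s set \<Rightarrow> ('s, 'a) ring_scheme \<Rightarrow> bool"
  where "prime_ideal P S \<longleftrightarrow>
    ideal P S \<and> P \<noteq> carrier S \<and>
    (\<forall>I J. ideal I S \<longrightarrow> ideal J S \<longrightarrow> I \<cdot>\<^bsub>S\<^esub> J \<subseteq> P \<longrightarrow> I \<subseteq> P \<or> J \<subseteq> P)"


text \<open>
  Only the additive structure of \<open>A\<close> matters for internal direct sums; \<open>A\<close> may be a ring
  or a module. A decomposition is an extensional function on the index set, so
  that it is determined by its components.
\<close>

definition decomposition ::
    "'g set \<Rightarrow> ('a, 'b) ring_scheme \<Rightarrow> ('g \<Rightarrow> 'a set) \<Rightarrow> 'a \<Rightarrow> ('g \<Rightarrow> 'a) \<Rightarrow> bool"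
  where "decomposition I A F x f \<longleftrightarrow>
    f \<in> (\<Pi>\<^sub>E g\<in>I. F g) \<and> finite {g \<in> I. f g \<noteq> \<zero>\<^bsub>A\<^esub>} \<and>
    x = (\<Oplus>\<^bsub>A\<^esub>g\<in>{g \<in> I. f g \<noteq> \<zero>\<^bsub>A\<^esub>}. f g)"

definition internal_direct_sum :: "'g set \<Rightarrow> ('a, 'b) ring_scheme \<Rightarrow> ('g \<Rightarrow> 'a set) \<Rightarrow> bool"
  where "internal_direct_sum I A F \<longleftrightarrow>
    abelian_group A \<and> (\<forall>g\<in>I. additive_subgroup (F g) A) \<and>
    (\<forall>x\<in>carrier A. \<exists>!f. decomposition I A F x f)"

definition component ::
    "'g set \<Rightarrow> ('a, 'b) ring_scheme \<Rightarrow> ('g \<Rightarrow> 'a set) \<Rightarrow> 'a \<Rightarrow> 'g \<Rightarrow> 'a"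
  where "component I A F x = (THE f. decomposition I A F x f)"

definition homogeneous_set ::
    "'g set \<Rightarrow> ('a, 'b) ring_scheme \<Rightarrow> ('g \<Rightarrow> 'a set) \<Rightarrow> 'a set \<Rightarrow> bool"
  where "homogeneous_set I A F X \<longleftrightarrow>
    X \<subseteq> carrier A \<and> (\<forall>x\<in>X. \<forall>g\<in>I. component I A F x g \<in> X)"

locale graded_ring = G?: monoid G + S?: ring S
  for G (structure) and S (structure) and Sg :: "'g \<Rightarrow> 's set" +
  assumes ring_direct_sum: "internal_direct_sum (carrier G) S Sg"
    and ring_graded_mult:
      "\<lbrakk>g \<in> carrier G; h \<in> carrier G; s \<in> Sg g; t \<in> Sg h\<rbrakk> \<Longrightarrow> s \<otimes>\<^bsub>S\<^esub> t \<in> Sg (g \<otimes>\<^bsub>G\<^esub> h)"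
    and ring_graded_one: "\<one>\<^bsub>S\<^esub> \<in> Sg \<one>\<^bsub>G\<^esub>"

locale graded_right_module = graded_ring G S Sg + right_module S M
  for G (structure) and S (structure) and Sg :: "'g \<Rightarrow> 's set"
    and M (structure) and Mg :: "'g \<Rightarrow> 'm set" +
  assumes module_direct_sum: "internal_direct_sum (carrier G) M Mg"
    and module_graded_rsmult:
      "\<lbrakk>g \<in> carrier G; h \<in> carrier G; x \<in> Mg g; s \<in> Sg h\<rbrakk> \<Longrightarrow> x \<star>\<^bsub>M\<^esub> s \<in> Mg (g \<otimes>\<^bsub>G\<^esub> h)"

end

theory Submission
  imports Defs
begin

text \<open>
  Let \<open>x\<close> be a nonzero element of \<open>N\<close> whose support has the least possible cardinality. Multiplying
  \<open>x\<close> by a homogeneous element of \<open>S\<close> either kills all components of \<open>x\<close> or none of them. By the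
  unique product property the annihilator of \<open>x\<close> is therefore homogeneous, and it coincides with
  the annihilator of each nonzero component \<open>x\<^sub>g\<close>. The same applies to the nonzero products of \<open>x\<close>
  with homogeneous elements, so \<open>ann (xS)\<close> is homogeneous, and it is \<open>ann N\<close> because \<open>N\<close> is prime.
  Finally \<open>x\<^sub>gS\<close> is graded, and it is isomorphic to the prime module \<open>xS\<close>.
\<close>

section \<open>Prime modules and annihilators\<close>

context right_module
begin

section \<open>Arithmetic of the right action\<close>

lemma rsmult_zero_left:
  assumes "s \<in> carrier S"
  shows "\<zero>\<^bsub>M\<^esub> \<star>\<^bsub>M\<^esub> s = \<zero>\<^bsub>M\<^esub>"
proof -
  have "\<zero>\<^bsub>M\<^esub> \<star>\<^bsub>M\<^esub> s = \<zero>\<^bsub>M\<^esub> \<star>\<^bsub>M\<^esub> s \<oplus>\<^bsub>M\<^esub> \<zero>\<^bsub>M\<^esub> \<star>\<^bsub>M\<^esub> s"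
    using rsmult_add_left[of "\<zero>\<^bsub>M\<^esub>" "\<zero>\<^bsub>M\<^esub>" s] assms by simp
  then show ?thesis
    using assms rsmult_closed by (metis M.add.r_cancel_one' M.zero_closed)
qed

lemma rsmult_zero_right:
  assumes "x \<in> carrier M"
  shows "x \<star>\<^bsub>M\<^esub> \<zero>\<^bsub>S\<^esub> = \<zero>\<^bsub>M\<^esub>"
proof -
  have "x \<star>\<^bsub>M\<^esub> \<zero>\<^bsub>S\<^esub> = x \<star>\<^bsub>M\<^esub> \<zero>\<^bsub>S\<^esub> \<oplus>\<^bsub>M\<^esub> x \<star>\<^bsub>M\<^esub> \<zero>\<^bsub>S\<^esub>"
    using rsmult_add_right[of x "\<zero>\<^bsub>S\<^esub>" "\<zero>\<^bsub>S\<^esub>"] assms by simp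
  then show ?thesis
    using assms rsmult_closed by (metis M.add.r_cancel_one' S.zero_closed)
qed

text \<open>Writing negation as the action of \<open>-1\<close> makes closure under negatives
  automatic for sets stable under the action. This is why \<open>right_submoduleI\<close> does not
  ask for it, and it supplies the inverses in \<open>right_module_submodule\<close>.\<close>

lemma rsmult_a_inv_one:
  assumes "x \<in> carrier M"
  shows "\<ominus>\<^bsub>M\<^esub> x = x \<star>\<^bsub>M\<^esub> (\<ominus>\<^bsub>S\<^esub> \<one>\<^bsub>S\<^esub>)"
proof -
  have "x \<star>\<^bsub>M\<^esub> (\<ominus>\<^bsub>S\<^esub> \<one>\<^bsub>S\<^esub>) \<oplus>\<^bsub>M\<^esub> x = x \<star>\<^bsub>M\<^esub> (\<ominus>\<^bsub>S\<^esub> \<one>\<^bsub>S\<^esub> \<oplus>\<^bsub>S\<^esub> \<one>\<^bsub>S\<^esub>)"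
    using assms by (simp add: rsmult_add_right rsmult_one)
  then have "x \<star>\<^bsub>M\<^esub> (\<ominus>\<^bsub>S\<^esub> \<one>\<^bsub>S\<^esub>) \<oplus>\<^bsub>M\<^esub> x = \<zero>\<^bsub>M\<^esub>"
    using assms by (simp add: S.l_neg rsmult_zero_right)
  then show ?thesis
    using assms rsmult_closed by (simp add: M.minus_equality)
qed

lemma rsmult_finsum_left:
  assumes "f \<in> J \<rightarrow> carrier M" "s \<in> carrier S"
  shows "(\<Oplus>\<^bsub>M\<^esub>j\<in>J. f j) \<star>\<^bsub>M\<^esub> s = (\<Oplus>\<^bsub>M\<^esub>j\<in>J. f j \<star>\<^bsub>M\<^esub> s)"
  using assms
proof (induction J rule: infinite_finite_induct)
  case (insert j J)
  then have "(\<lambda>j. f j \<star>\<^bsub>M\<^esub> s) \<in> J \<rightarrow> carrier M" "f \<in> J \<rightarrow> carrier M"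
    using rsmult_closed by auto
  with insert show ?case
    by (simp add: rsmult_add_left rsmult_closed)
qed (simp_all add: rsmult_zero_left)

lemma rsmult_finsum_right:
  assumes "f \<in> J \<rightarrow> carrier S" "x \<in> carrier M"
  shows "x \<star>\<^bsub>M\<^esub> (\<Oplus>\<^bsub>S\<^esub>j\<in>J. f j) = (\<Oplus>\<^bsub>M\<^esub>j\<in>J. x \<star>\<^bsub>M\<^esub> f j)"
  using assms
proof (induction J rule: infinite_finite_induct)
  case (insert j J)
  then have "(\<lambda>j. x \<star>\<^bsub>M\<^esub> f j) \<in> J \<rightarrow> carrier M" "f \<in> J \<rightarrow> carrier S"
    using rsmult_closed by auto
  with insert show ?case
    by (simp add: rsmult_add_right rsmult_closed)
qed (simp_all add: rsmult_zero_right)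

section \<open>Submodules and prime submodules\<close>

lemma right_submoduleI:
  assumes "K \<subseteq> carrier M" "\<zero>\<^bsub>M\<^esub> \<in> K"
    and "\<And>x y. \<lbrakk>x \<in> K; y \<in> K\<rbrakk> \<Longrightarrow> x \<oplus>\<^bsub>M\<^esub> y \<in> K"
    and "\<And>x s. \<lbrakk>x \<in> K; s \<in> carrier S\<rbrakk> \<Longrightarrow> x \<star>\<^bsub>M\<^esub> s \<in> K"
  shows "right_submodule K S M"
proof (intro right_submodule.intro right_submodule_axioms.intro additive_subgroupI)
  show "subgroup K (add_monoid M)"
  proof (rule M.add.subgroupI)
    fix x assume "x \<in> K"
    then show "\<ominus>\<^bsub>M\<^esub> x \<in> K"
      using assms(1,4) rsmult_a_inv_one by auto
  qed (use assms in auto)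
qed (use assms in auto)

lemma right_submoduleD:
  assumes "right_submodule K S M"
  shows "K \<subseteq> carrier M" "\<zero>\<^bsub>M\<^esub> \<in> K"
    and "\<And>x y. \<lbrakk>x \<in> K; y \<in> K\<rbrakk> \<Longrightarrow> x \<oplus>\<^bsub>M\<^esub> y \<in> K"
    and "\<And>x s. \<lbrakk>x \<in> K; s \<in> carrier S\<rbrakk> \<Longrightarrow> x \<star>\<^bsub>M\<^esub> s \<in> K"
proof -
  interpret K: right_submodule K S M by fact
  show "K \<subseteq> carrier M" "\<zero>\<^bsub>M\<^esub> \<in> K"
    and "\<And>x y. \<lbrakk>x \<in> K; y \<in> K\<rbrakk> \<Longrightarrow> x \<oplus>\<^bsub>M\<^esub> y \<in> K"
    and "\<And>x s. \<lbrakk>x \<in> K; s \<in> carrier S\<rbrakk> \<Longrightarrow> x \<star>\<^bsub>M\<^esub> s \<in> K"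
    using K.a_subset K.rsmult_closed by auto
qed

lemma right_submodule_finsum_closed:
  assumes "right_submodule K S M" "f \<in> J \<rightarrow> K"
  shows "(\<Oplus>\<^bsub>M\<^esub>j\<in>J. f j) \<in> K"
  using assms(2)
proof (induction J rule: infinite_finite_induct)
  case (insert j J)
  then have "f \<in> J \<rightarrow> carrier M" "f j \<in> carrier M"
    using right_submoduleD(1)[OF assms(1)] by auto
  with insert right_submoduleD(3)[OF assms(1)] show ?case by simp
qed (simp_all add: right_submoduleD(2)[OF assms(1)])

lemma right_module_submodule:
  assumes "right_submodule N S M"
  shows "right_module S (M\<lparr>carrier := N\<rparr>)"
proof -
  note N = right_submoduleD[OF assms]
  have carr: "x \<in> carrier M" if "x \<in> N" for x
    using N(1) that by blast
  have "abelian_group (M\<lparr>carrier := N\<rparr>)"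
  proof (rule abelian_groupI; simp)
    fix x assume x: "x \<in> N"
    then have "x \<star>\<^bsub>M\<^esub> (\<ominus>\<^bsub>S\<^esub> \<one>\<^bsub>S\<^esub>) \<in> N"
      using N(4) by simp
    then show "\<exists>y\<in>N. y \<oplus>\<^bsub>M\<^esub> x = \<zero>\<^bsub>M\<^esub>"
      using x carr M.l_neg by (metis rsmult_a_inv_one)
  qed (auto simp: N(2,3) M.a_ac carr)
  then show ?thesis
    by (intro right_module.intro right_module_axioms.intro S.ring_axioms)
      (auto simp: N(4) carr rsmult_add_left rsmult_add_right rsmult_assoc rsmult_one)
qed

lemma right_submodule_of_submodule_iff:
  assumes "right_submodule N S M"
  shows "right_submodule K S (M\<lparr>carrier := N\<rparr>) \<longleftrightarrow> right_submodule K S M \<and> K \<subseteq> N"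
proof -
  interpret N: right_module S "M\<lparr>carrier := N\<rparr>"
    using right_module_submodule[OF assms] .
  have "right_submodule K S M \<and> K \<subseteq> N" if K: "right_submodule K S (M\<lparr>carrier := N\<rparr>)"
    using N.right_submoduleD[OF K] right_submoduleD(1)[OF assms] right_submoduleI[of K] by auto
  moreover have "right_submodule K S (M\<lparr>carrier := N\<rparr>)"
    if K: "right_submodule K S M" "K \<subseteq> N"
    using right_submoduleD[OF K(1)] K(2) N.right_submoduleI[of K] by auto
  ultimately show ?thesis by blast
qed

lemma ann_submodule: "ann S (M\<lparr>carrier := N\<rparr>) X = ann S M X"
  by (simp add: ann_def)

text \<open>Restricting the carrier changes neither the operations nor the annihilators. Primeness
  of \<open>N\<close> can therefore be tested inside \<open>M\<close>, and the restricted module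
  does not appear again.\<close>

lemma prime_submodule_iff:
  "prime_submodule N S M \<longleftrightarrow> right_submodule N S M \<and> N \<noteq> {\<zero>\<^bsub>M\<^esub>} \<and>
    (\<forall>K. right_submodule K S M \<longrightarrow> K \<subseteq> N \<longrightarrow> K \<noteq> {\<zero>\<^bsub>M\<^esub>} \<longrightarrow> ann S M K = ann S M N)"
proof (cases "right_submodule N S M")
  case True
  show ?thesis
    using True right_module_submodule[OF True]
    unfolding prime_submodule_def prime_module_def
      right_submodule_of_submodule_iff[OF True] ann_submodule
    by auto
qed (simp add: prime_submodule_def)

section \<open>Annihilators of prime submodules\<close>

lemma ideal_ann:
  assumes "right_submodule N S M"
  shows "ideal (ann S M N) S"
proof -
  note N = right_submoduleD[OF assms]
  have carr: "x \<in> carrier M" if "x \<in> N" for x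
    using N(1) that by blast
  have neg: "x \<star>\<^bsub>M\<^esub> (\<ominus>\<^bsub>S\<^esub> s) = \<zero>\<^bsub>M\<^esub>"
    if "x \<in> N" "s \<in> carrier S" "x \<star>\<^bsub>M\<^esub> s = \<zero>\<^bsub>M\<^esub>" for x s
  proof -
    \<comment> \<open>With the sign moved to the right factor, \<open>s\<close> acts on
      \<open>x\<close> first and gives zero.\<close>
    have "\<ominus>\<^bsub>S\<^esub> s = s \<otimes>\<^bsub>S\<^esub> (\<ominus>\<^bsub>S\<^esub> \<one>\<^bsub>S\<^esub>)"
      using that by (simp add: S.r_minus)
    then show ?thesis
      using that carr by (simp add: rsmult_assoc rsmult_zero_left)
  qed
  show ?thesis
  proof (rule idealI[OF S.ring_axioms])
    show "subgroup (ann S M N) (add_monoid S)"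
    proof (rule S.add.subgroupI)
      show "ann S M N \<noteq> {}"
        using carr rsmult_zero_right by (auto simp: ann_def)
    qed (use carr neg in \<open>auto simp: ann_def rsmult_add_right\<close>)
  qed (use carr N(4) in \<open>auto simp: ann_def rsmult_assoc rsmult_zero_left\<close>)
qed

text \<open>If \<open>I\<close> does not annihilate \<open>N\<close>, some
  \<open>y \<star> i\<close> is nonzero. Since the product ideal of \<open>I\<close> and
  \<open>J\<close> annihilates \<open>N\<close>, this element lies in the submodule \<open>K\<close>
  of all elements of \<open>N\<close> killed by \<open>J\<close>. So \<open>K\<close> is nonzero,
  and primeness turns \<open>J \<subseteq> ann S M K\<close> into
  \<open>J \<subseteq> ann S M N\<close>.\<close>

lemma prime_ideal_ann:
  assumes "prime_submodule N S M"
  shows "prime_ideal (ann S M N) S"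
  unfolding prime_ideal_def
proof (intro conjI allI impI)
  have sub: "right_submodule N S M" and ne: "N \<noteq> {\<zero>\<^bsub>M\<^esub>}"
    and prime: "\<And>K. \<lbrakk>right_submodule K S M; K \<subseteq> N; K \<noteq> {\<zero>\<^bsub>M\<^esub>}\<rbrakk> \<Longrightarrow> ann S M K = ann S M N"
    using assms unfolding prime_submodule_iff by blast+
  note N = right_submoduleD[OF sub]
  have carr: "x \<in> carrier M" if "x \<in> N" for x
    using N(1) that by blast
  show "ideal (ann S M N) S"
    using ideal_ann[OF sub] .
  obtain x where x: "x \<in> N" "x \<noteq> \<zero>\<^bsub>M\<^esub>"
    using ne N(2) by blast
  then have "\<one>\<^bsub>S\<^esub> \<notin> ann S M N"
    using carr by (auto simp: ann_def rsmult_one)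
  then show "ann S M N \<noteq> carrier S"
    by auto
  fix I J assume I: "ideal I S" and J: "ideal J S" and IJ: "I \<cdot>\<^bsub>S\<^esub> J \<subseteq> ann S M N"
  interpret I: ideal I S by fact
  interpret J: ideal J S by fact
  have "J \<subseteq> ann S M N" if "\<not> I \<subseteq> ann S M N"
  proof -
    from that obtain i y where i: "i \<in> I" and y: "y \<in> N" "y \<star>\<^bsub>M\<^esub> i \<noteq> \<zero>\<^bsub>M\<^esub>"
      using I.Icarr by (auto simp: ann_def)
    define K where "K = {z \<in> N. \<forall>j\<in>J. z \<star>\<^bsub>M\<^esub> j = \<zero>\<^bsub>M\<^esub>}"
    have K: "right_submodule K S M"
    proof (rule right_submoduleI)
      show "K \<subseteq> carrier M"
        using N(1) by (auto simp: K_def)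
      show "\<zero>\<^bsub>M\<^esub> \<in> K"
        using N(2) J.Icarr by (auto simp: K_def rsmult_zero_left)
      show "z \<oplus>\<^bsub>M\<^esub> w \<in> K" if "z \<in> K" "w \<in> K" for z w
        using that N(3) carr J.Icarr by (auto simp: K_def rsmult_add_left)
      \<comment> \<open>Stability holds because \<open>J\<close> absorbs the factor \<open>s\<close>
        from the left: \<open>z \<star> s\<close> acts on \<open>j\<close> as \<open>z\<close> acts
        on an element of \<open>J\<close>.\<close>
      show "z \<star>\<^bsub>M\<^esub> s \<in> K" if "z \<in> K" "s \<in> carrier S" for z s
        using that N(4) carr J.Icarr J.I_l_closed by (auto simp: K_def simp flip: rsmult_assoc)
    qed
    have "y \<star>\<^bsub>M\<^esub> i \<in> K"
    proof -
      have "(y \<star>\<^bsub>M\<^esub> i) \<star>\<^bsub>M\<^esub> j = \<zero>\<^bsub>M\<^esub>" if j: "j \<in> J" for j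
      proof -
        have "i \<otimes>\<^bsub>S\<^esub> j \<in> ann S M N"
          using IJ ideal_prod.prod[OF i j] by blast
        then show ?thesis
          using y(1) carr I.Icarr[OF i] J.Icarr[OF j]
          by (auto simp: ann_def simp flip: rsmult_assoc)
      qed
      then show ?thesis
        using N(4) y(1) I.Icarr[OF i] by (auto simp: K_def)
    qed
    then have "ann S M K = ann S M N"
      using prime[OF K] y(2) by (auto simp: K_def)
    moreover have "J \<subseteq> ann S M K"
      using J.Icarr by (auto simp: ann_def K_def)
    ultimately show "J \<subseteq> ann S M N" by simp
  qed
  then show "I \<subseteq> ann S M N \<or> J \<subseteq> ann S M N" by blast
qed

text \<open>Nonzero submodules of \<open>K\<close> are also nonzero submodules of \<open>N\<close>,
  so all their annihilators equal \<open>ann S M N\<close>.\<close>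

lemma prime_submodule_mono:
  assumes "prime_submodule N S M" "right_submodule K S M" "K \<subseteq> N" "K \<noteq> {\<zero>\<^bsub>M\<^esub>}"
  shows "prime_submodule K S M" "ann S M K = ann S M N"
proof -
  show *: "ann S M K = ann S M N"
    using assms unfolding prime_submodule_iff by blast
  show "prime_submodule K S M"
    using assms * unfolding prime_submodule_iff by (metis subset_trans)
qed

section \<open>Cyclic submodules\<close>

lemma right_submodule_cyclic:
  assumes "x \<in> carrier M"
  shows "right_submodule ((\<lambda>s. x \<star>\<^bsub>M\<^esub> s) ` carrier S) S M"
proof (rule right_submoduleI)
  show "(\<lambda>s. x \<star>\<^bsub>M\<^esub> s) ` carrier S \<subseteq> carrier M"
    using assms rsmult_closed by auto
  show "\<zero>\<^bsub>M\<^esub> \<in> (\<lambda>s. x \<star>\<^bsub>M\<^esub> s) ` carrier S"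
    using rsmult_zero_right[OF assms] by (metis S.zero_closed imageI)
next
  fix y z assume "y \<in> (\<lambda>s. x \<star>\<^bsub>M\<^esub> s) ` carrier S" "z \<in> (\<lambda>s. x \<star>\<^bsub>M\<^esub> s) ` carrier S"
  then obtain s t where "s \<in> carrier S" "t \<in> carrier S" "y = x \<star>\<^bsub>M\<^esub> s" "z = x \<star>\<^bsub>M\<^esub> t"
    by blast
  then show "y \<oplus>\<^bsub>M\<^esub> z \<in> (\<lambda>s. x \<star>\<^bsub>M\<^esub> s) ` carrier S"
    using assms by (auto intro!: image_eqI[of _ _ "s \<oplus>\<^bsub>S\<^esub> t"] simp: rsmult_add_right)
next
  fix y t assume "y \<in> (\<lambda>s. x \<star>\<^bsub>M\<^esub> s) ` carrier S" "t \<in> carrier S"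
  then obtain s where "s \<in> carrier S" "t \<in> carrier S" "y = x \<star>\<^bsub>M\<^esub> s"
    by blast
  then show "y \<star>\<^bsub>M\<^esub> t \<in> (\<lambda>s. x \<star>\<^bsub>M\<^esub> s) ` carrier S"
    using assms by (auto intro!: image_eqI[of _ _ "s \<otimes>\<^bsub>S\<^esub> t"] simp: rsmult_assoc)
qed

lemma in_cyclic:
  "x \<in> carrier M \<Longrightarrow> x \<in> (\<lambda>s. x \<star>\<^bsub>M\<^esub> s) ` carrier S"
  by (rule image_eqI[of _ _ "\<one>\<^bsub>S\<^esub>"]) (simp_all add: rsmult_one)

text \<open>The right-hand side only asks which ring elements kill \<open>x\<close>, so it depends
  on \<open>x\<close> through \<open>ann S M {x}\<close> alone.\<close>

lemma ann_image_rsmult: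
  assumes "x \<in> carrier M" "T \<subseteq> carrier S"
  shows "ann S M ((\<lambda>t. x \<star>\<^bsub>M\<^esub> t) ` T) =
    {s \<in> carrier S. \<forall>t\<in>T. x \<star>\<^bsub>M\<^esub> (t \<otimes>\<^bsub>S\<^esub> s) = \<zero>\<^bsub>M\<^esub>}"
  using assms by (auto simp: ann_def rsmult_assoc subset_iff)

text \<open>
  Elements with the same annihilator generate isomorphic cyclic submodules, so \<open>x \<star> t \<mapsto> y \<star> t\<close>
  carries submodules of the one back to submodules of the other.
\<close>

lemma prime_submodule_cyclic_transfer:
  assumes x: "x \<in> carrier M" and y: "y \<in> carrier M"
    and ann: "ann S M {x} = ann S M {y}"
    and prime: "prime_submodule ((\<lambda>s. x \<star>\<^bsub>M\<^esub> s) ` carrier S) S M"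
  shows "prime_submodule ((\<lambda>s. y \<star>\<^bsub>M\<^esub> s) ` carrier S) S M"
    and "ann S M ((\<lambda>s. y \<star>\<^bsub>M\<^esub> s) ` carrier S) = ann S M ((\<lambda>s. x \<star>\<^bsub>M\<^esub> s) ` carrier S)"
proof -
  have zero_iff: "x \<star>\<^bsub>M\<^esub> s = \<zero>\<^bsub>M\<^esub> \<longleftrightarrow> y \<star>\<^bsub>M\<^esub> s = \<zero>\<^bsub>M\<^esub>" if "s \<in> carrier S" for s
    using ann that by (auto simp: ann_def)
  have ann_T: "ann S M ((\<lambda>t. y \<star>\<^bsub>M\<^esub> t) ` T) = ann S M ((\<lambda>t. x \<star>\<^bsub>M\<^esub> t) ` T)"
    if "T \<subseteq> carrier S" for T
    unfolding ann_image_rsmult[OF x that] ann_image_rsmult[OF y that]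
    using that by (auto simp: zero_iff subset_iff)
  then show ann_eq: "ann S M ((\<lambda>s. y \<star>\<^bsub>M\<^esub> s) ` carrier S) = ann S M ((\<lambda>s. x \<star>\<^bsub>M\<^esub> s) ` carrier S)"
    by simp
  have nonzero: "x \<noteq> \<zero>\<^bsub>M\<^esub>"
    using prime in_cyclic[OF x] by (auto simp: prime_submodule_iff rsmult_zero_left)
  then have "y \<noteq> \<zero>\<^bsub>M\<^esub>"
    using zero_iff[OF S.one_closed] x y by (simp add: rsmult_one)
  then have "(\<lambda>s. y \<star>\<^bsub>M\<^esub> s) ` carrier S \<noteq> {\<zero>\<^bsub>M\<^esub>}"
    using in_cyclic[OF y] by blast
  moreover have "ann S M K = ann S M ((\<lambda>s. y \<star>\<^bsub>M\<^esub> s) ` carrier S)"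
    if K: "right_submodule K S M" "K \<subseteq> (\<lambda>s. y \<star>\<^bsub>M\<^esub> s) ` carrier S" "K \<noteq> {\<zero>\<^bsub>M\<^esub>}" for K
  proof -
    note KD = right_submoduleD[OF K(1)]
    \<comment> \<open>\<open>T\<close> is the preimage of \<open>K\<close> under
      \<open>t \<mapsto> y \<star> t\<close>. Its image under \<open>t \<mapsto> x \<star> t\<close>
      is the submodule corresponding to \<open>K\<close>, so no isomorphism has to be
      constructed.\<close>
    define T where "T = {t \<in> carrier S. y \<star>\<^bsub>M\<^esub> t \<in> K}"
    have T: "T \<subseteq> carrier S"
      by (auto simp: T_def)
    have yT: "(\<lambda>t. y \<star>\<^bsub>M\<^esub> t) ` T = K"
      using K(2) by (auto simp: T_def)
    have "right_submodule ((\<lambda>t. x \<star>\<^bsub>M\<^esub> t) ` T) S M"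
    proof (rule right_submoduleI)
      show "(\<lambda>t. x \<star>\<^bsub>M\<^esub> t) ` T \<subseteq> carrier M"
        using x T rsmult_closed by auto
      have "\<zero>\<^bsub>S\<^esub> \<in> T"
        using y KD(2) by (simp add: T_def rsmult_zero_right)
      then show "\<zero>\<^bsub>M\<^esub> \<in> (\<lambda>t. x \<star>\<^bsub>M\<^esub> t) ` T"
        using rsmult_zero_right[OF x] by (metis imageI)
    next
      fix u v assume "u \<in> (\<lambda>t. x \<star>\<^bsub>M\<^esub> t) ` T" "v \<in> (\<lambda>t. x \<star>\<^bsub>M\<^esub> t) ` T"
      then obtain s t where st: "s \<in> T" "t \<in> T" "u = x \<star>\<^bsub>M\<^esub> s" "v = x \<star>\<^bsub>M\<^esub> t"
        by blast
      then have "s \<oplus>\<^bsub>S\<^esub> t \<in> T"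
        using KD(3) y by (simp add: T_def rsmult_add_right)
      moreover have "u \<oplus>\<^bsub>M\<^esub> v = x \<star>\<^bsub>M\<^esub> (s \<oplus>\<^bsub>S\<^esub> t)"
        using st T x by (simp add: rsmult_add_right subset_iff)
      ultimately show "u \<oplus>\<^bsub>M\<^esub> v \<in> (\<lambda>t. x \<star>\<^bsub>M\<^esub> t) ` T"
        by blast
    next
      fix u t assume "u \<in> (\<lambda>t. x \<star>\<^bsub>M\<^esub> t) ` T" and t: "t \<in> carrier S"
      then obtain s where s: "s \<in> T" "u = x \<star>\<^bsub>M\<^esub> s"
        by blast
      then have "s \<otimes>\<^bsub>S\<^esub> t \<in> T"
        using KD(4) y t by (simp add: T_def rsmult_assoc)
      moreover have "u \<star>\<^bsub>M\<^esub> t = x \<star>\<^bsub>M\<^esub> (s \<otimes>\<^bsub>S\<^esub> t)"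
        using s T t x by (simp add: rsmult_assoc subset_iff)
      ultimately show "u \<star>\<^bsub>M\<^esub> t \<in> (\<lambda>t. x \<star>\<^bsub>M\<^esub> t) ` T"
        by blast
    qed
    moreover have "(\<lambda>t. x \<star>\<^bsub>M\<^esub> t) ` T \<noteq> {\<zero>\<^bsub>M\<^esub>}"
    proof -
      obtain k where "k \<in> K" "k \<noteq> \<zero>\<^bsub>M\<^esub>"
        using K(3) KD(2) by blast
      then obtain t where "t \<in> T" "y \<star>\<^bsub>M\<^esub> t \<noteq> \<zero>\<^bsub>M\<^esub>"
        using yT by blast
      then show ?thesis
        using zero_iff T by blast
    qed
    ultimately have "ann S M ((\<lambda>t. x \<star>\<^bsub>M\<^esub> t) ` T) = ann S M ((\<lambda>s. x \<star>\<^bsub>M\<^esub> s) ` carrier S)"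
      using prime_submodule_mono(2)[OF prime] T by blast
    then show ?thesis
      using ann_T[OF T] ann_eq yT by simp
  qed
  ultimately show "prime_submodule ((\<lambda>s. y \<star>\<^bsub>M\<^esub> s) ` carrier S) S M"
    using right_submodule_cyclic[OF y] unfolding prime_submodule_iff by blast
qed

text \<open>Replaces \<open>N\<close> by the submodule generated by any one of its nonzero elements,
  so that a generator can be chosen freely.\<close>

lemma ann_cyclic_eq_ann:
  assumes "prime_submodule N S M" "x \<in> N" "x \<noteq> \<zero>\<^bsub>M\<^esub>"
  shows "prime_submodule ((\<lambda>s. x \<star>\<^bsub>M\<^esub> s) ` carrier S) S M"
    and "ann S M ((\<lambda>s. x \<star>\<^bsub>M\<^esub> s) ` carrier S) = ann S M N"
proof -
  have N: "right_submodule N S M"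
    using assms(1) by (simp add: prime_submodule_iff)
  then have x: "x \<in> carrier M"
    using right_submoduleD(1) assms(2) by blast
  have "(\<lambda>s. x \<star>\<^bsub>M\<^esub> s) ` carrier S \<subseteq> N"
    using right_submoduleD(4)[OF N assms(2)] by blast
  moreover have "(\<lambda>s. x \<star>\<^bsub>M\<^esub> s) ` carrier S \<noteq> {\<zero>\<^bsub>M\<^esub>}"
    using in_cyclic[OF x] assms(3) by blast
  ultimately show "prime_submodule ((\<lambda>s. x \<star>\<^bsub>M\<^esub> s) ` carrier S) S M"
    and "ann S M ((\<lambda>s. x \<star>\<^bsub>M\<^esub> s) ` carrier S) = ann S M N"
    using prime_submodule_mono[OF assms(1) right_submodule_cyclic[OF x]] by blast+
qed

end

section \<open>Components in a direct sum\<close>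

definition support ::
    "'g set \<Rightarrow> ('a, 'b) ring_scheme \<Rightarrow> ('g \<Rightarrow> 'a set) \<Rightarrow> 'a \<Rightarrow> 'g set"
  where "support I A F x = {g \<in> I. component I A F x g \<noteq> \<zero>\<^bsub>A\<^esub>}"

text \<open>Uses the additive structure only, so that one set of facts about components serves both
  the ring \<open>S\<close> and the module \<open>M\<close>.\<close>

locale direct_sum = abelian_group A for I and A (structure) and F +
  assumes direct_sum: "internal_direct_sum I A F"
begin

lemma summand_subgroup: "g \<in> I \<Longrightarrow> additive_subgroup (F g) A"
  using direct_sum by (simp add: internal_direct_sum_def)

lemma summand_carrier: "\<lbrakk>g \<in> I; x \<in> F g\<rbrakk> \<Longrightarrow> x \<in> carrier A"
  using additive_subgroup.a_subset[OF summand_subgroup] by blast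

lemma decomposition_component:
  assumes "x \<in> carrier A"
  shows "decomposition I A F x (component I A F x)"
proof -
  have "\<exists>!f. decomposition I A F x f"
    using direct_sum assms by (simp add: internal_direct_sum_def)
  from theI'[OF this] show ?thesis
    by (simp add: component_def)
qed

lemma decomposition_unique:
  assumes "x \<in> carrier A" "decomposition I A F x f"
  shows "component I A F x = f"
proof -
  have "\<exists>!f. decomposition I A F x f"
    using direct_sum assms(1) by (simp add: internal_direct_sum_def)
  then show ?thesis
    using assms(2) decomposition_component[OF assms(1)] by (metis the1_equality)
qed

lemma component_in_summand:
  assumes "x \<in> carrier A" "g \<in> I"
  shows "component I A F x g \<in> F g"
  using decomposition_component[OF assms(1)] assms(2) by (auto simp: decomposition_def)

lemma component_carrier:
  assumes "x \<in> carrier A" "g \<in> I"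
  shows "component I A F x g \<in> carrier A"
  using component_in_summand[OF assms] summand_carrier assms by blast

lemma finite_support: "x \<in> carrier A \<Longrightarrow> finite (support I A F x)"
  using decomposition_component by (auto simp: decomposition_def support_def)

lemma support_subset: "support I A F x \<subseteq> I"
  by (auto simp: support_def)

text \<open>Allowing any finite \<open>J\<close> that contains the support makes it possible to
  expand two elements over a common index set, as in \<open>component_add\<close>.\<close>

lemma finsum_component:
  assumes "x \<in> carrier A" "finite J" "support I A F x \<subseteq> J" "J \<subseteq> I"
  shows "(\<Oplus>g\<in>J. component I A F x g) = x"
proof -
  have "(\<Oplus>g\<in>support I A F x. component I A F x g) = (\<Oplus>g\<in>J. component I A F x g)"
    by (rule add.finprod_mono_neutral_cong_left)
      (use assms component_carrier in \<open>auto simp: support_def\<close>)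
  then show ?thesis
    using decomposition_component[OF assms(1)] by (simp add: decomposition_def support_def)
qed

text \<open>By uniqueness of decompositions, any finite family of summands with sum \<open>x\<close>
  is the family of components. The other computations of components rest on this.\<close>

lemma componentI:
  assumes "finite J" "J \<subseteq> I" "x = (\<Oplus>g\<in>J. f g)"
    and "\<And>g. g \<in> J \<Longrightarrow> f g \<in> F g" "\<And>g. g \<in> I - J \<Longrightarrow> f g = \<zero>" "g \<in> I"
  shows "component I A F x g = f g"
proof -
  have F: "f h \<in> F h" if "h \<in> I" for h
    using that assms(4,5) additive_subgroup.zero_closed[OF summand_subgroup[OF that]]
    by (cases "h \<in> J") auto
  have carr: "f \<in> J \<rightarrow> carrier A"
    using assms(2,4) summand_carrier by blast
  \<comment> \<open>A decomposition is extensional and is summed exactly over its nonzero values.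
    Hence \<open>f\<close> is restricted to \<open>I\<close>, and indices of \<open>J\<close> where
    it vanishes are dropped.\<close>
  have "(\<Oplus>g\<in>{h \<in> I. f h \<noteq> \<zero>}. restrict f I g) = (\<Oplus>g\<in>J. f g)"
    by (rule add.finprod_mono_neutral_cong_left)
      (use assms(1,2,5) carr in auto)
  moreover have "{h \<in> I. restrict f I h \<noteq> \<zero>} = {h \<in> I. f h \<noteq> \<zero>}"
    by auto
  moreover have "finite {h \<in> I. f h \<noteq> \<zero>}"
    by (rule finite_subset[OF _ assms(1)]) (use assms(5) in auto)
  ultimately have "decomposition I A F x (restrict f I)"
    using F assms(3) by (simp add: decomposition_def)
  moreover have "x \<in> carrier A"
    using assms(3) carr by simp
  ultimately show ?thesis
    using decomposition_unique[of x "restrict f I"] assms(6) by simp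
qed

lemma component_zero: "g \<in> I \<Longrightarrow> component I A F \<zero> g = \<zero>"
  by (rule componentI[of "{}" _ "\<lambda>_. \<zero>"]) auto

lemma component_add:
  assumes "x \<in> carrier A" "y \<in> carrier A" "g \<in> I"
  shows "component I A F (x \<oplus> y) g = component I A F x g \<oplus> component I A F y g"
proof (rule componentI[where J = "support I A F x \<union> support I A F y"
      and f = "\<lambda>g. component I A F x g \<oplus> component I A F y g"])
  let ?J = "support I A F x \<union> support I A F y"
  show J: "finite ?J" "?J \<subseteq> I"
    using finite_support assms support_subset by auto
  have "(\<Oplus>g\<in>?J. component I A F x g \<oplus> component I A F y g) =
      (\<Oplus>g\<in>?J. component I A F x g) \<oplus> (\<Oplus>g\<in>?J. component I A F y g)"
    by (rule finsum_addf) (use J(2) assms component_carrier in auto)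
  then show "x \<oplus> y = (\<Oplus>g\<in>?J. component I A F x g \<oplus> component I A F y g)"
    using finsum_component[OF assms(1) J(1) _ J(2)] finsum_component[OF assms(2) J(1) _ J(2)]
    by simp
  fix h
  show "component I A F x h \<oplus> component I A F y h \<in> F h" if "h \<in> ?J"
    using that J(2) assms(1,2)
    by (blast intro: additive_subgroup.a_closed summand_subgroup component_in_summand)
  show "component I A F x h \<oplus> component I A F y h = \<zero>" if "h \<in> I - ?J"
    using that by (auto simp: support_def)
qed (fact assms)

lemma component_finsum:
  assumes "f \<in> J \<rightarrow> carrier A" "g \<in> I"
  shows "component I A F (\<Oplus>j\<in>J. f j) g = (\<Oplus>j\<in>J. component I A F (f j) g)"
  using assms(1)
proof (induction J rule: infinite_finite_induct)
  case (insert j J)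
  then have "(\<lambda>j. component I A F (f j) g) \<in> J \<rightarrow> carrier A" "f \<in> J \<rightarrow> carrier A"
    using component_carrier assms(2) by auto
  with insert show ?case
    using assms(2) by (simp add: component_add component_carrier)
qed (simp_all add: component_zero assms(2))

lemma component_homogeneous:
  assumes "h \<in> I" "x \<in> F h" "g \<in> I"
  shows "component I A F x g = (if g = h then x else \<zero>)"
  by (rule componentI[where J = "{h}" and f = "\<lambda>g. if g = h then x else \<zero>"]) (use assms summand_carrier in auto)

lemma support_eq_empty_iff:
  assumes "x \<in> carrier A"
  shows "support I A F x = {} \<longleftrightarrow> x = \<zero>"
  using finsum_component[OF assms, of "{}"] by (auto simp: support_def component_zero)

end

section \<open>Elements of minimal support\<close>

text \<open>For distinct \<open>g\<close> and \<open>g'\<close> the sets \<open>{g, g'}\<close> and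
  \<open>{h}\<close> would have no unique product. Cancellation keeps distinct components apart
  under multiplication by a homogeneous ring element.\<close>

lemma (in unique_product_monoid) right_cancel:
  assumes "g \<in> carrier G" "g' \<in> carrier G" "h \<in> carrier G" "g \<otimes> h = g' \<otimes> h"
  shows "g = g'"
proof (rule ccontr)
  assume "g \<noteq> g'"
  obtain x y where "x \<in> {g, g'}" "y \<in> {h}"
    and "\<forall>(x', y') \<in> {g, g'} \<times> {h}. (x', y') \<noteq> (x, y) \<longrightarrow> x \<otimes> y \<noteq> x' \<otimes> y'"
    using unique_product[of "{g, g'}" "{h}"] assms(1-3) by blast
  then show False
    using \<open>g \<noteq> g'\<close> assms(4) by auto
qed

locale unique_product_graded_module =
  graded_right_module G S Sg M Mg + unique_product_monoid G
  for G (structure) and S (structure) and Sg :: "'g \<Rightarrow> 's set"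
    and M (structure) and Mg :: "'g \<Rightarrow> 'm set"
begin

sublocale S_sum: direct_sum "carrier G" S Sg
  by unfold_locales (rule ring_direct_sum)

sublocale M_sum: direct_sum "carrier G" M Mg
  by unfold_locales (rule module_direct_sum)

abbreviation "s_comp \<equiv> component (carrier G) S Sg"
abbreviation "s_supp \<equiv> support (carrier G) S Sg"
abbreviation "m_comp \<equiv> component (carrier G) M Mg"
abbreviation "m_supp \<equiv> support (carrier G) M Mg"

section \<open>Components and supports of products\<close>

lemma rsmult_eq_finsum:
  assumes "x \<in> carrier M" "s \<in> carrier S"
  shows "x \<star>\<^bsub>M\<^esub> s = (\<Oplus>\<^bsub>M\<^esub>h\<in>s_supp s. x \<star>\<^bsub>M\<^esub> s_comp s h)"
proof -
  have "(\<Oplus>\<^bsub>S\<^esub>h\<in>s_supp s. s_comp s h) = s"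
    using S_sum.finsum_component[OF assms(2) S_sum.finite_support[OF assms(2)] _ S_sum.support_subset]
    by simp
  moreover have "s_comp s \<in> s_supp s \<rightarrow> carrier S"
    using S_sum.component_carrier[OF assms(2)] S_sum.support_subset[of s] by blast
  ultimately show ?thesis
    using rsmult_finsum_right[of "s_comp s" "s_supp s" x] assms(1) by simp
qed

text \<open>Each \<open>m_comp x g \<star> s\<close> is homogeneous of degree
  \<open>g \<otimes> h\<close> and contributes to that component only. Cancellation enters later, in
  \<open>component_rsmult_mult\<close>, where it leaves a single term.\<close>

lemma component_rsmult:
  assumes x: "x \<in> carrier M" and h: "h \<in> carrier G" "s \<in> Sg h" and k: "k \<in> carrier G"
  shows "m_comp (x \<star>\<^bsub>M\<^esub> s) k =
    (\<Oplus>\<^bsub>M\<^esub>g\<in>m_supp x. if k = g \<otimes>\<^bsub>G\<^esub> h then m_comp x g \<star>\<^bsub>M\<^esub> s else \<zero>\<^bsub>M\<^esub>)"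
proof -
  have s: "s \<in> carrier S"
    using S_sum.summand_carrier h by blast
  have G: "g \<in> carrier G" "m_comp x g \<in> carrier M" "m_comp x g \<star>\<^bsub>M\<^esub> s \<in> Mg (g \<otimes>\<^bsub>G\<^esub> h)"
    "m_comp x g \<star>\<^bsub>M\<^esub> s \<in> carrier M" if "g \<in> m_supp x" for g
  proof -
    show g: "g \<in> carrier G"
      using that M_sum.support_subset by blast
    show "m_comp x g \<in> carrier M"
      using M_sum.component_carrier[OF x g] .
    then show "m_comp x g \<star>\<^bsub>M\<^esub> s \<in> carrier M"
      using s rsmult_closed by blast
    show "m_comp x g \<star>\<^bsub>M\<^esub> s \<in> Mg (g \<otimes>\<^bsub>G\<^esub> h)"
      using module_graded_rsmult[OF g h(1) M_sum.component_in_summand[OF x g] h(2)] .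
  qed
  have "(\<Oplus>\<^bsub>M\<^esub>g\<in>m_supp x. m_comp x g) = x"
    using M_sum.finsum_component[OF x M_sum.finite_support[OF x] _ M_sum.support_subset] by simp
  then have "x \<star>\<^bsub>M\<^esub> s = (\<Oplus>\<^bsub>M\<^esub>g\<in>m_supp x. m_comp x g \<star>\<^bsub>M\<^esub> s)"
    using rsmult_finsum_left[of "m_comp x" "m_supp x" s] G(2) s by auto
  then have "m_comp (x \<star>\<^bsub>M\<^esub> s) k = (\<Oplus>\<^bsub>M\<^esub>g\<in>m_supp x. m_comp (m_comp x g \<star>\<^bsub>M\<^esub> s) k)"
    using M_sum.component_finsum[of "\<lambda>g. m_comp x g \<star>\<^bsub>M\<^esub> s" "m_supp x" k] G(4) k by auto
  also have "\<dots> = (\<Oplus>\<^bsub>M\<^esub>g\<in>m_supp x. if k = g \<otimes>\<^bsub>G\<^esub> h then m_comp x g \<star>\<^bsub>M\<^esub> s else \<zero>\<^bsub>M\<^esub>)"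
  proof (rule M.add.finprod_cong')
    show "m_comp (m_comp x g \<star>\<^bsub>M\<^esub> s) k = (if k = g \<otimes>\<^bsub>G\<^esub> h then m_comp x g \<star>\<^bsub>M\<^esub> s else \<zero>\<^bsub>M\<^esub>)"
      if "g \<in> m_supp x" for g
      using M_sum.component_homogeneous[OF _ G(3)[OF that] k] G(1)[OF that] h(1) by simp
  qed (use G(4) in auto)
  finally show ?thesis .
qed

lemma component_rsmult_mult:
  assumes x: "x \<in> carrier M" and g: "g \<in> carrier G" and h: "h \<in> carrier G" "s \<in> Sg h"
  shows "m_comp (x \<star>\<^bsub>M\<^esub> s) (g \<otimes>\<^bsub>G\<^esub> h) = m_comp x g \<star>\<^bsub>M\<^esub> s"
proof -
  have s: "s \<in> carrier S"
    using S_sum.summand_carrier h by blast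
  have carr: "(\<lambda>g'. m_comp x g' \<star>\<^bsub>M\<^esub> s) \<in> m_supp x \<rightarrow> carrier M"
    using M_sum.component_carrier[OF x] M_sum.support_subset s rsmult_closed by blast
  have "m_comp (x \<star>\<^bsub>M\<^esub> s) (g \<otimes>\<^bsub>G\<^esub> h) =
      (\<Oplus>\<^bsub>M\<^esub>g'\<in>m_supp x. if g \<otimes>\<^bsub>G\<^esub> h = g' \<otimes>\<^bsub>G\<^esub> h then m_comp x g' \<star>\<^bsub>M\<^esub> s else \<zero>\<^bsub>M\<^esub>)"
    using component_rsmult[OF x h] g h(1) by simp
  also have "\<dots> = (\<Oplus>\<^bsub>M\<^esub>g'\<in>m_supp x. if g = g' then m_comp x g' \<star>\<^bsub>M\<^esub> s else \<zero>\<^bsub>M\<^esub>)"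
  proof (rule M.add.finprod_cong')
    fix g' assume "g' \<in> m_supp x"
    then have "g \<otimes>\<^bsub>G\<^esub> h = g' \<otimes>\<^bsub>G\<^esub> h \<longleftrightarrow> g = g'"
      using right_cancel[OF g _ h(1)] M_sum.support_subset by blast
    then show "(if g \<otimes>\<^bsub>G\<^esub> h = g' \<otimes>\<^bsub>G\<^esub> h then m_comp x g' \<star>\<^bsub>M\<^esub> s else \<zero>\<^bsub>M\<^esub>) =
      (if g = g' then m_comp x g' \<star>\<^bsub>M\<^esub> s else \<zero>\<^bsub>M\<^esub>)" by simp
  qed (use carr in auto)
  also have "\<dots> = m_comp x g \<star>\<^bsub>M\<^esub> s"
  proof (cases "g \<in> m_supp x")
    case True
    then show ?thesis
      using M.finsum_singleton[OF True M_sum.finite_support[OF x] carr] by simp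
  next
    case False
    then have "m_comp x g = \<zero>\<^bsub>M\<^esub>"
      using g by (simp add: support_def)
    moreover have "(\<Oplus>\<^bsub>M\<^esub>g'\<in>m_supp x. if g = g' then m_comp x g' \<star>\<^bsub>M\<^esub> s else \<zero>\<^bsub>M\<^esub>) = \<zero>\<^bsub>M\<^esub>"
      by (rule M.add.finprod_one_eqI) (use False in auto)
    ultimately show ?thesis
      using rsmult_zero_left[OF s] by simp
  qed
  finally show ?thesis .
qed

text \<open>The support is translated by \<open>h\<close>, and indices whose component is killed by
  \<open>s\<close> are lost. This loss is what makes the cardinality drop in
  \<open>minimal_support_uniform\<close>.\<close>

lemma support_rsmult:
  assumes x: "x \<in> carrier M" and h: "h \<in> carrier G" "s \<in> Sg h"
  shows "m_supp (x \<star>\<^bsub>M\<^esub> s) \<subseteq>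
    (\<lambda>g. g \<otimes>\<^bsub>G\<^esub> h) ` {g \<in> m_supp x. m_comp x g \<star>\<^bsub>M\<^esub> s \<noteq> \<zero>\<^bsub>M\<^esub>}"
proof
  fix k assume k: "k \<in> m_supp (x \<star>\<^bsub>M\<^esub> s)"
  then have kG: "k \<in> carrier G" and nz: "m_comp (x \<star>\<^bsub>M\<^esub> s) k \<noteq> \<zero>\<^bsub>M\<^esub>"
    by (auto simp: support_def)
  show "k \<in> (\<lambda>g. g \<otimes>\<^bsub>G\<^esub> h) ` {g \<in> m_supp x. m_comp x g \<star>\<^bsub>M\<^esub> s \<noteq> \<zero>\<^bsub>M\<^esub>}"
  proof (rule ccontr)
    assume "k \<notin> (\<lambda>g. g \<otimes>\<^bsub>G\<^esub> h) ` {g \<in> m_supp x. m_comp x g \<star>\<^bsub>M\<^esub> s \<noteq> \<zero>\<^bsub>M\<^esub>}"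
    then have "(\<Oplus>\<^bsub>M\<^esub>g\<in>m_supp x. if k = g \<otimes>\<^bsub>G\<^esub> h then m_comp x g \<star>\<^bsub>M\<^esub> s else \<zero>\<^bsub>M\<^esub>) = \<zero>\<^bsub>M\<^esub>"
      by (intro M.add.finprod_one_eqI) auto
    then show False
      using nz component_rsmult[OF x h kG] by simp
  qed
qed

section \<open>Uniform elements and their annihilators\<close>

text \<open>Isolates what the unique product argument needs from minimality of the support, so that
  the argument also applies to homogeneous elements, in particular to single components of
  \<open>x\<close>.\<close>

definition uniform :: "'m \<Rightarrow> bool"
  where "uniform x \<longleftrightarrow> x \<in> carrier M \<and>
    (\<forall>g\<in>m_supp x. \<forall>h\<in>carrier G. \<forall>s\<in>Sg h. m_comp x g \<star>\<^bsub>M\<^esub> s = \<zero>\<^bsub>M\<^esub> \<longrightarrow> x \<star>\<^bsub>M\<^esub> s = \<zero>\<^bsub>M\<^esub>)"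

lemma uniform_homogeneous:
  assumes "g \<in> carrier G" "x \<in> Mg g"
  shows "uniform x"
proof -
  have "m_comp x k = x" if "k \<in> m_supp x" for k
    using that M_sum.component_homogeneous[OF assms, of k]
    by (auto simp: support_def split: if_splits)
  then show ?thesis
    using M_sum.summand_carrier[OF assms] by (simp add: uniform_def)
qed

text \<open>
  If some \<open>x \<star> s\<^sub>h\<close> were nonzero, a unique product of the supports of \<open>x\<close> and of those components
  of \<open>s\<close> would exhibit a component \<open>x\<^sub>g \<star> s\<^sub>h\<close> of \<open>x \<star> s\<close>, forcing it to vanish.
\<close>

lemma uniform_rsmult_component_eq_zero:
  assumes u: "uniform x" and s: "s \<in> carrier S" and zero: "x \<star>\<^bsub>M\<^esub> s = \<zero>\<^bsub>M\<^esub>"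
    and h: "h \<in> carrier G"
  shows "x \<star>\<^bsub>M\<^esub> s_comp s h = \<zero>\<^bsub>M\<^esub>"
proof (rule ccontr)
  assume nz: "x \<star>\<^bsub>M\<^esub> s_comp s h \<noteq> \<zero>\<^bsub>M\<^esub>"
  have x: "x \<in> carrier M"
    using u by (simp add: uniform_def)
  \<comment> \<open>Degrees whose component of \<open>s\<close> already kills \<open>x\<close> are
    left out. They contribute nothing to \<open>x \<star> s\<close>, and membership of
    \<open>b\<close> in \<open>Y\<close> gives the final contradiction.\<close>
  define Y where "Y = {h \<in> carrier G. x \<star>\<^bsub>M\<^esub> s_comp s h \<noteq> \<zero>\<^bsub>M\<^esub>}"
  have Y_supp: "Y \<subseteq> s_supp s"
    using rsmult_zero_right[OF x] by (auto simp: Y_def support_def)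
  then have finY: "finite Y"
    using S_sum.finite_support[OF s] finite_subset by blast
  have YG: "Y \<subseteq> carrier G"
    by (auto simp: Y_def)
  have "Y \<noteq> {}"
    using nz h by (auto simp: Y_def)
  have Sgh: "s_comp s h \<in> Sg h" "x \<star>\<^bsub>M\<^esub> s_comp s h \<in> carrier M" if "h \<in> carrier G" for h
    using that S_sum.component_in_summand[OF s] S_sum.component_carrier[OF s] rsmult_closed[OF x]
    by auto
  have "x \<noteq> \<zero>\<^bsub>M\<^esub>"
    using nz rsmult_zero_left S_sum.component_carrier[OF s h] by blast
  then have "m_supp x \<noteq> {}"
    using M_sum.support_eq_empty_iff[OF x] by simp
  then obtain a b where a: "a \<in> m_supp x" and b: "b \<in> Y"
    and ab: "\<forall>(a', b') \<in> m_supp x \<times> Y. (a', b') \<noteq> (a, b) \<longrightarrow> a \<otimes>\<^bsub>G\<^esub> b \<noteq> a' \<otimes>\<^bsub>G\<^esub> b'"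
    using unique_product[OF M_sum.support_subset YG M_sum.finite_support[OF x] finY _ \<open>Y \<noteq> {}\<close>]
    by blast
  have aG: "a \<in> carrier G" and bG: "b \<in> carrier G"
    using a b M_sum.support_subset YG by blast+
  have "x \<star>\<^bsub>M\<^esub> s = (\<Oplus>\<^bsub>M\<^esub>h\<in>Y. x \<star>\<^bsub>M\<^esub> s_comp s h)"
    unfolding rsmult_eq_finsum[OF x s]
    by (rule M.add.finprod_mono_neutral_cong_right)
      (use S_sum.finite_support[OF s] Y_supp S_sum.support_subset[of s] Sgh in \<open>auto simp: Y_def\<close>)
  then have "m_comp (x \<star>\<^bsub>M\<^esub> s) (a \<otimes>\<^bsub>G\<^esub> b) = (\<Oplus>\<^bsub>M\<^esub>h\<in>Y. m_comp (x \<star>\<^bsub>M\<^esub> s_comp s h) (a \<otimes>\<^bsub>G\<^esub> b))"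
    using M_sum.component_finsum[of "\<lambda>h. x \<star>\<^bsub>M\<^esub> s_comp s h" Y "a \<otimes>\<^bsub>G\<^esub> b"] Sgh YG aG bG by auto
  \<comment> \<open>A term with \<open>h \<noteq> b\<close> reaching this degree would give a second
    factorization of \<open>a \<otimes> b\<close> over the two supports.\<close>
  also have "\<dots> = (\<Oplus>\<^bsub>M\<^esub>h\<in>Y. if b = h then m_comp (x \<star>\<^bsub>M\<^esub> s_comp s h) (a \<otimes>\<^bsub>G\<^esub> b) else \<zero>\<^bsub>M\<^esub>)"
  proof (rule M.add.finprod_cong')
    fix h assume hY: "h \<in> Y"
    have "m_comp (x \<star>\<^bsub>M\<^esub> s_comp s h) (a \<otimes>\<^bsub>G\<^esub> b) = \<zero>\<^bsub>M\<^esub>" if "b \<noteq> h"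
    proof (rule ccontr)
      assume "m_comp (x \<star>\<^bsub>M\<^esub> s_comp s h) (a \<otimes>\<^bsub>G\<^esub> b) \<noteq> \<zero>\<^bsub>M\<^esub>"
      then have "a \<otimes>\<^bsub>G\<^esub> b \<in> m_supp (x \<star>\<^bsub>M\<^esub> s_comp s h)"
        using aG bG by (simp add: support_def)
      moreover have "h \<in> carrier G"
        using hY YG by blast
      ultimately obtain a' where "a' \<in> m_supp x" "a \<otimes>\<^bsub>G\<^esub> b = a' \<otimes>\<^bsub>G\<^esub> h"
        using support_rsmult[OF x _ Sgh(1)] by blast
      then show False
        using ab hY that by auto
    qed
    then show "m_comp (x \<star>\<^bsub>M\<^esub> s_comp s h) (a \<otimes>\<^bsub>G\<^esub> b) =
      (if b = h then m_comp (x \<star>\<^bsub>M\<^esub> s_comp s h) (a \<otimes>\<^bsub>G\<^esub> b) else \<zero>\<^bsub>M\<^esub>)" by simp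
  qed (use YG Sgh aG bG M_sum.component_carrier in auto)
  also have "\<dots> = m_comp (x \<star>\<^bsub>M\<^esub> s_comp s b) (a \<otimes>\<^bsub>G\<^esub> b)"
    by (rule M.finsum_singleton[OF b finY]) (use YG Sgh aG bG M_sum.component_carrier in auto)
  also have "\<dots> = m_comp x a \<star>\<^bsub>M\<^esub> s_comp s b"
    using component_rsmult_mult[OF x aG bG Sgh(1)[OF bG]] .
  finally have "m_comp x a \<star>\<^bsub>M\<^esub> s_comp s b = \<zero>\<^bsub>M\<^esub>"
    using zero M_sum.component_zero aG bG by simp
  then have "x \<star>\<^bsub>M\<^esub> s_comp s b = \<zero>\<^bsub>M\<^esub>"
    using u a bG Sgh(1)[OF bG] unfolding uniform_def by blast
  then show False
    using b by (simp add: Y_def)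
qed

text \<open>The annihilator of a uniform element is thus determined by its homogeneous elements,
  which reduces comparisons of such annihilators to homogeneous multipliers.\<close>

lemma uniform_rsmult_eq_zero_iff:
  assumes "uniform x" "s \<in> carrier S"
  shows "x \<star>\<^bsub>M\<^esub> s = \<zero>\<^bsub>M\<^esub> \<longleftrightarrow> (\<forall>h\<in>carrier G. x \<star>\<^bsub>M\<^esub> s_comp s h = \<zero>\<^bsub>M\<^esub>)"
proof
  assume zero: "\<forall>h\<in>carrier G. x \<star>\<^bsub>M\<^esub> s_comp s h = \<zero>\<^bsub>M\<^esub>"
  have x: "x \<in> carrier M"
    using assms(1) by (simp add: uniform_def)
  show "x \<star>\<^bsub>M\<^esub> s = \<zero>\<^bsub>M\<^esub>"
    unfolding rsmult_eq_finsum[OF x assms(2)]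
    by (rule M.add.finprod_one_eqI) (use zero S_sum.support_subset in auto)
qed (use uniform_rsmult_component_eq_zero[OF assms] in blast)

text \<open>Both \<open>x\<close> and its component are uniform, so it suffices to compare
  homogeneous multipliers \<open>t\<close> of degree \<open>h\<close>. One direction is uniformity
  of \<open>x\<close>; the other reads off the component of \<open>x \<star> t\<close> in degree
  \<open>g \<otimes> h\<close>.\<close>

lemma uniform_ann_component:
  assumes u: "uniform x" and g: "g \<in> m_supp x"
  shows "ann S M {m_comp x g} = ann S M {x}"
proof -
  have x: "x \<in> carrier M"
    using u by (simp add: uniform_def)
  have gG: "g \<in> carrier G"
    using g M_sum.support_subset by blast
  have ug: "uniform (m_comp x g)"
    using uniform_homogeneous[OF gG M_sum.component_in_summand[OF x gG]] .
  have hom: "m_comp x g \<star>\<^bsub>M\<^esub> t = \<zero>\<^bsub>M\<^esub> \<longleftrightarrow> x \<star>\<^bsub>M\<^esub> t = \<zero>\<^bsub>M\<^esub>" if h: "h \<in> carrier G" "t \<in> Sg h" for h t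
  proof
    assume "x \<star>\<^bsub>M\<^esub> t = \<zero>\<^bsub>M\<^esub>"
    then show "m_comp x g \<star>\<^bsub>M\<^esub> t = \<zero>\<^bsub>M\<^esub>"
      using component_rsmult_mult[OF x gG h] M_sum.component_zero gG h(1) by simp
  qed (use u g h in \<open>auto simp: uniform_def\<close>)
  have "m_comp x g \<star>\<^bsub>M\<^esub> s = \<zero>\<^bsub>M\<^esub> \<longleftrightarrow> x \<star>\<^bsub>M\<^esub> s = \<zero>\<^bsub>M\<^esub>" if s: "s \<in> carrier S" for s
    unfolding uniform_rsmult_eq_zero_iff[OF u s] uniform_rsmult_eq_zero_iff[OF ug s]
    using hom S_sum.component_in_summand[OF s] by blast
  then show ?thesis
    by (auto simp: ann_def)
qed

section \<open>Minimality of the support inside a submodule\<close>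

text \<open>Supports are compared by cardinality rather than by inclusion because homogeneous
  multipliers translate them.\<close>

definition minimal_support :: "'m set \<Rightarrow> 'm \<Rightarrow> bool"
  where "minimal_support N x \<longleftrightarrow> x \<in> N \<and> x \<noteq> \<zero>\<^bsub>M\<^esub> \<and>
    (\<forall>y\<in>N. y \<noteq> \<zero>\<^bsub>M\<^esub> \<longrightarrow> card (m_supp x) \<le> card (m_supp y))"

lemma ex_minimal_support:
  assumes "x \<in> N" "x \<noteq> \<zero>\<^bsub>M\<^esub>"
  shows "\<exists>x. minimal_support N x"
  using ex_has_least_nat[of "\<lambda>x. x \<in> N \<and> x \<noteq> \<zero>\<^bsub>M\<^esub>" x "\<lambda>x. card (m_supp x)"] assms
  by (auto simp: minimal_support_def)

text \<open>If \<open>s\<close> kills the component at \<open>g\<close>, the support of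
  \<open>x \<star> s\<close> lies in a translate of the support of \<open>x\<close> without
  \<open>g\<close>. It is then too small for a nonzero element of \<open>N\<close>.\<close>

lemma minimal_support_uniform:
  assumes N: "right_submodule N S M" and min: "minimal_support N x"
  shows "uniform x"
  unfolding uniform_def
proof (intro conjI ballI impI)
  have xN: "x \<in> N"
    using min by (simp add: minimal_support_def)
  then show x: "x \<in> carrier M"
    using right_submoduleD(1)[OF N] by blast
  fix g h s assume g: "g \<in> m_supp x" and h: "h \<in> carrier G" "s \<in> Sg h"
    and zero: "m_comp x g \<star>\<^bsub>M\<^esub> s = \<zero>\<^bsub>M\<^esub>"
  have fin: "finite (m_supp x)"
    using M_sum.finite_support[OF x] .
  have "m_supp (x \<star>\<^bsub>M\<^esub> s) \<subseteq> (\<lambda>g. g \<otimes>\<^bsub>G\<^esub> h) ` (m_supp x - {g})"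
    using support_rsmult[OF x h] zero by blast
  then have "card (m_supp (x \<star>\<^bsub>M\<^esub> s)) \<le> card (m_supp x - {g})"
    using fin by (meson surj_card_le finite_Diff)
  also have "\<dots> < card (m_supp x)"
    using fin g by (rule card_Diff1_less)
  finally have "\<not> card (m_supp x) \<le> card (m_supp (x \<star>\<^bsub>M\<^esub> s))"
    by simp
  moreover have "x \<star>\<^bsub>M\<^esub> s \<in> N"
    using right_submoduleD(4)[OF N xN] S_sum.summand_carrier[OF h] by blast
  ultimately show "x \<star>\<^bsub>M\<^esub> s = \<zero>\<^bsub>M\<^esub>"
    using min unfolding minimal_support_def by blast
qed

text \<open>Translation does not enlarge a support. Uniformity thereby becomes available for all
  nonzero homogeneous multiples of \<open>x\<close>, as needed for the annihilator of the whole
  cyclic submodule.\<close>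

lemma minimal_support_rsmult:
  assumes N: "right_submodule N S M" and min: "minimal_support N x"
    and h: "h \<in> carrier G" "s \<in> Sg h" and nz: "x \<star>\<^bsub>M\<^esub> s \<noteq> \<zero>\<^bsub>M\<^esub>"
  shows "minimal_support N (x \<star>\<^bsub>M\<^esub> s)"
proof -
  have xN: "x \<in> N"
    using min by (simp add: minimal_support_def)
  then have x: "x \<in> carrier M"
    using right_submoduleD(1)[OF N] by blast
  have "m_supp (x \<star>\<^bsub>M\<^esub> s) \<subseteq> (\<lambda>g. g \<otimes>\<^bsub>G\<^esub> h) ` m_supp x"
    using support_rsmult[OF x h] by blast
  then have "card (m_supp (x \<star>\<^bsub>M\<^esub> s)) \<le> card (m_supp x)"
    using M_sum.finite_support[OF x] by (meson surj_card_le)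
  moreover have "x \<star>\<^bsub>M\<^esub> s \<in> N"
    using right_submoduleD(4)[OF N xN] S_sum.summand_carrier[OF h] by blast
  ultimately show ?thesis
    using min nz unfolding minimal_support_def by (meson order_trans)
qed

section \<open>Homogeneity of the annihilator and of the new submodule\<close>

lemma homogeneous_ann_cyclic:
  assumes N: "right_submodule N S M" and min: "minimal_support N x"
  shows "homogeneous_set (carrier G) S Sg (ann S M ((\<lambda>s. x \<star>\<^bsub>M\<^esub> s) ` carrier S))"
  unfolding homogeneous_set_def
proof (intro conjI ballI)
  have x: "x \<in> carrier M"
    using min right_submoduleD(1)[OF N] by (auto simp: minimal_support_def)
  show "ann S M ((\<lambda>s. x \<star>\<^bsub>M\<^esub> s) ` carrier S) \<subseteq> carrier S"
    by (auto simp: ann_def)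
  fix s h assume s: "s \<in> ann S M ((\<lambda>s. x \<star>\<^bsub>M\<^esub> s) ` carrier S)" and h: "h \<in> carrier G"
  then have sS: "s \<in> carrier S"
    by (simp add: ann_def)
  then have sh: "s_comp s h \<in> carrier S"
    using S_sum.component_carrier h by blast
  have "(x \<star>\<^bsub>M\<^esub> t) \<star>\<^bsub>M\<^esub> s_comp s h = \<zero>\<^bsub>M\<^esub>" if t: "t \<in> carrier S" for t
  proof -
    \<comment> \<open>The multiplier \<open>t\<close> is split into components because minimality of
      the support is passed on to homogeneous multiples. Each nonzero piece is uniform and killed by
      \<open>s\<close>, hence by every component of \<open>s\<close>.\<close>
    have hom: "(x \<star>\<^bsub>M\<^esub> s_comp t k) \<star>\<^bsub>M\<^esub> s_comp s h = \<zero>\<^bsub>M\<^esub>" if k: "k \<in> carrier G" for k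
    proof (cases "x \<star>\<^bsub>M\<^esub> s_comp t k = \<zero>\<^bsub>M\<^esub>")
      case True
      then show ?thesis
        using rsmult_zero_left[OF sh] by simp
    next
      case False
      have "uniform (x \<star>\<^bsub>M\<^esub> s_comp t k)"
        using minimal_support_uniform[OF N]
          minimal_support_rsmult[OF N min k S_sum.component_in_summand[OF t k] False] by blast
      moreover have "(x \<star>\<^bsub>M\<^esub> s_comp t k) \<star>\<^bsub>M\<^esub> s = \<zero>\<^bsub>M\<^esub>"
        using s S_sum.component_carrier[OF t k] by (auto simp: ann_def)
      ultimately show ?thesis
        using uniform_rsmult_component_eq_zero sS h by blast
    qed
    have "(\<lambda>k. x \<star>\<^bsub>M\<^esub> s_comp t k) \<in> s_supp t \<rightarrow> carrier M"
      using rsmult_closed[OF x] S_sum.component_carrier[OF t] S_sum.support_subset[of t] by blast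
    then have "(x \<star>\<^bsub>M\<^esub> t) \<star>\<^bsub>M\<^esub> s_comp s h =
        (\<Oplus>\<^bsub>M\<^esub>k\<in>s_supp t. (x \<star>\<^bsub>M\<^esub> s_comp t k) \<star>\<^bsub>M\<^esub> s_comp s h)"
      unfolding rsmult_eq_finsum[OF x t] using rsmult_finsum_left sh by blast
    also have "\<dots> = \<zero>\<^bsub>M\<^esub>"
      by (rule M.add.finprod_one_eqI) (use hom S_sum.support_subset in auto)
    finally show ?thesis .
  qed
  then show "s_comp s h \<in> ann S M ((\<lambda>s. x \<star>\<^bsub>M\<^esub> s) ` carrier S)"
    using sh by (auto simp: ann_def)
qed

text \<open>Since \<open>x\<close> is homogeneous, each \<open>x \<star> s_comp s h\<close> lives in
  one degree, so its components are itself or zero. Components of \<open>x \<star> s\<close> are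
  sums of these.\<close>

lemma homogeneous_cyclic:
  assumes g: "g \<in> carrier G" "x \<in> Mg g"
  shows "homogeneous_set (carrier G) M Mg ((\<lambda>s. x \<star>\<^bsub>M\<^esub> s) ` carrier S)" (is "homogeneous_set _ _ _ ?K")
  unfolding homogeneous_set_def
proof (intro conjI ballI)
  have x: "x \<in> carrier M"
    using M_sum.summand_carrier[OF g] .
  have K: "right_submodule ?K S M"
    using right_submodule_cyclic[OF x] .
  show "?K \<subseteq> carrier M"
    using right_submoduleD(1)[OF K] .
  fix y k assume "y \<in> ?K" and k: "k \<in> carrier G"
  then obtain s where s: "s \<in> carrier S" and y: "y = x \<star>\<^bsub>M\<^esub> s"
    by blast
  have hom: "m_comp (x \<star>\<^bsub>M\<^esub> s_comp s h) k \<in> ?K" if h: "h \<in> carrier G" for h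
  proof -
    have "x \<star>\<^bsub>M\<^esub> s_comp s h \<in> Mg (g \<otimes>\<^bsub>G\<^esub> h)"
      using module_graded_rsmult[OF g(1) h g(2) S_sum.component_in_summand[OF s h]] .
    from M_sum.component_homogeneous[OF _ this k]
    have "m_comp (x \<star>\<^bsub>M\<^esub> s_comp s h) k \<in> {x \<star>\<^bsub>M\<^esub> s_comp s h, \<zero>\<^bsub>M\<^esub>}"
      using g(1) h by simp
    then show ?thesis
      using right_submoduleD(2)[OF K] S_sum.component_carrier[OF s h] by auto
  qed
  have "(\<lambda>h. x \<star>\<^bsub>M\<^esub> s_comp s h) \<in> s_supp s \<rightarrow> carrier M"
    using rsmult_closed[OF x] S_sum.component_carrier[OF s] S_sum.support_subset[of s] by blast
  then have "m_comp y k = (\<Oplus>\<^bsub>M\<^esub>h\<in>s_supp s. m_comp (x \<star>\<^bsub>M\<^esub> s_comp s h) k)"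
    unfolding y rsmult_eq_finsum[OF x s] using M_sum.component_finsum k by blast
  also have "\<dots> \<in> ?K"
    by (rule right_submodule_finsum_closed[OF K]) (use hom S_sum.support_subset in blast)
  finally show "m_comp y k \<in> ?K" .
qed

end

theorem corollary2p6:
  fixes G :: "('g, 'a) monoid_scheme"
    and S :: "('s, 'b) ring_scheme" and Sg :: "'g \<Rightarrow> 's set"
    and M :: "('s, 'm, 'c) right_module_scheme" and Mg :: "'g \<Rightarrow> 'm set"
    and N :: "'m set"
  assumes "unique_product_monoid G"
    and "graded_ring G S Sg"
    and "graded_right_module G S Sg M Mg"
    and "prime_submodule N S M"
  shows "homogeneous_set (carrier G) S Sg (ann S M N) \<and>
    prime_ideal (ann S M N) S \<and>
    (\<exists>N'. prime_submodule N' S M \<and> homogeneous_set (carrier G) M Mg N' \<and>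
          ann S M N = ann S M N')"
proof -
  interpret unique_product_graded_module G S Sg M Mg
    by (intro unique_product_graded_module.intro assms)
  have N: "right_submodule N S M" and ne: "N \<noteq> {\<zero>\<^bsub>M\<^esub>}"
    using assms(4) by (auto simp: prime_submodule_iff)
  obtain x where min: "minimal_support N x"
    using ne right_submoduleD(2)[OF N] ex_minimal_support by blast
  then have xN: "x \<in> N" "x \<noteq> \<zero>\<^bsub>M\<^esub>"
    by (auto simp: minimal_support_def)
  then have x: "x \<in> carrier M"
    using right_submoduleD(1)[OF N] by blast
  obtain g where g: "g \<in> m_supp x"
    using xN(2) M_sum.support_eq_empty_iff[OF x] by blast
  then have gG: "g \<in> carrier G"
    using M_sum.support_subset by blast
  \<comment> \<open>A single component of \<open>x\<close> generates a graded submodule. It is not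
    known to lie in \<open>N\<close>, so its primeness is transferred from the cyclic submodule of
    \<open>x\<close>, whose generator has the same annihilator.\<close>
  define N' where "N' = (\<lambda>s. m_comp x g \<star>\<^bsub>M\<^esub> s) ` carrier S"
  note cyc = ann_cyclic_eq_ann[OF assms(4) xN]
  have ann_eq: "ann S M {x} = ann S M {m_comp x g}"
    using uniform_ann_component[OF minimal_support_uniform[OF N min] g] by simp
  note N' = prime_submodule_cyclic_transfer[OF x M_sum.component_carrier[OF x gG] ann_eq cyc(1),
      folded N'_def]
  have "homogeneous_set (carrier G) S Sg (ann S M N)"
    using homogeneous_ann_cyclic[OF N min] cyc(2) by simp
  moreover have "homogeneous_set (carrier G) M Mg N'"
    unfolding N'_def by (rule homogeneous_cyclic[OF gG M_sum.component_in_summand[OF x gG]])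
  moreover have "ann S M N = ann S M N'"
    using N'(2) cyc(2) by simp
  ultimately show ?thesis
    using prime_ideal_ann[OF assms(4)] N'(1) by blast
qed

end
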